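(* Let $A\subset S^1$ be a Borel set that has no translational symmetries, and assume that $$\int_{S^1}\frac{1}{\varphi_A(\varepsilon)}\,d\varepsilon=+\infty .$$ Let $v\in S^1$ be such that the translation $T_v:S^1\to S^1$ is minimal, and let $F_w^n$ be the random iterations associated with $A$ and $v$. Then for any $x,y\in S^1$, for $\mathbb{P}$-almost every $w\in\Omega$ one has $$\forall \delta>0\quad \frac1N\,\#\{n\in\{1,\dots,N\}\mid \operatorname{dist}(F_w^n(x),F_w^n(y))<\delta\}\to 1\quad\text{as } N\to\infty .$$
   Context: $S^1=\mathbb{T}^1=\mathbb{R}/\mathbb{Z}$ is the circle with its usual distance $\operatorname{dist}$ and normalized Lebesgue (Haar) probability measure $\mathrm{Leb}$; $T_u(x)=x+u$ is the translation by $u\in S^1$. Standing assumption: $v\in S^1$ is such that $v$ and $1$ are linearly independent over $\mathbb{Q}$ (equivalently, $T_v$ is minimal). For a Borel set $A\subset S^1$, its displacement function is $\varphi_A:S^1\to\mathbb{R}$, $\varphi_A(\varepsilon)=\mathrm{Leb}(A\,\triangle\,T_\varepsilon(A))$, where $\triangle$ is the symmetric difference. The set $A$ has no translational symmetries if $\varphi_A(\varepsilon)=0\Leftrightarrow\varepsilon=0$. Given $A$ and $v$, define $f:S^1\to S^1$ by $f(x)=x+v$ if $x\in A$ and $f(x)=x$ if $x\notin A$. For $u\in S^1$ put $f_u=T_u\circ f$. Let $\Omega=(S^1)^{\mathbb{N}}$ (sequences $w=(w_1,w_2,\dots)$) with the product probability measure $\mathbb{P}=\mathrm{Leb}^{\mathbb{N}}$.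 For $w\in\Omega$ set $F_w^n=f_{w_n}\circ\dots\circ f_{w_1}$. *)

theory Defs
  imports "HOL-Probability.Probability"
begin

quotient_type circle = real / "\<lambda>x y. x - y \<in> \<int>"
proof (rule equivpI)
  show "reflp (\<lambda>x y :: real. x - y \<in> \<int>)"
    by (simp add: reflp_def)
  show "symp (\<lambda>x y :: real. x - y \<in> \<int>)"
    by (metis (mono_tags, lifting) Ints_minus minus_diff_eq sympI)
  show "transp (\<lambda>x y :: real. x - y \<in> \<int>)"
  proof (rule transpI)
    fix x y z :: real
    assume "x - y \<in> \<int>" "y - z \<in> \<int>"
    from Ints_add[OF this] show "x - z \<in> \<int>" by simp
  qed
qed

instantiation circle :: ab_group_add
begin

lift_definition zero_circle :: circle is "0 :: real" .

lift_definition plus_circle :: "circle \<Rightarrow> circle \<Rightarrow> circle" is "(+)"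
  by (metis Ints_add add_diff_add)

lift_definition uminus_circle :: "circle \<Rightarrow> circle" is "uminus"
  by (metis Ints_minus minus_diff_minus)

lift_definition minus_circle :: "circle \<Rightarrow> circle \<Rightarrow> circle" is "(-)"
proof -
  fix a b c d :: real
  assume "a - b \<in> \<int>" "c - d \<in> \<int>"
  from Ints_diff[OF this] show "a - c - (b - d) \<in> \<int>"
    by (simp add: algebra_simps)
qed

instance
  by standard (transfer; simp)+

end

text \<open>
  The usual distance on the circle is the distance of \<open>x - y\<close> to the nearest
  integer, that is, the minimum of \<open>\<bar>a - b\<bar>\<close> over all representatives
  \<open>a\<close> of \<open>x\<close> and \<open>b\<close> of \<open>y\<close>.
\<close>

lemma dist_int_le: "\<bar>z - of_int (round z)\<bar> \<le> \<bar>z - of_int k\<bar>" for z :: real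
  using round_diff_minimal[of z k] by simp

lemma dist_int_cong:
  fixes a b :: real
  assumes "a - b \<in> \<int>"
  shows "\<bar>a - of_int (round a)\<bar> = \<bar>b - of_int (round b)\<bar>"
proof -
  obtain k where k: "a = b + of_int k"
    using assms by (metis Ints_cases add.commute diff_add_cancel)
  show ?thesis
    using dist_int_le[of a "round b + k"] dist_int_le[of b "round a - k"]
    by (simp add: k)
qed

instantiation circle :: metric_space
begin

lift_definition dist_circle :: "circle \<Rightarrow> circle \<Rightarrow> real"
  is "\<lambda>x y. \<bar>(x - y) - of_int (round (x - y))\<bar>"
proof -
  fix a b c d :: real
  assume "a - b \<in> \<int>" "c - d \<in> \<int>"
  from Ints_diff[OF this] have "(a - c) - (b - d) \<in> \<int>"
    by (simp add: algebra_simps)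
  then show "\<bar>(a - c) - of_int (round (a - c))\<bar> = \<bar>(b - d) - of_int (round (b - d))\<bar>"
    by (rule dist_int_cong)
qed

definition uniformity_circle :: "(circle \<times> circle) filter"
  where "uniformity_circle = (INF e\<in>{0 <..}. principal {(x, y). dist x y < e})"

definition open_circle :: "circle set \<Rightarrow> bool"
  where "open_circle U \<longleftrightarrow> (\<forall>x\<in>U. eventually (\<lambda>(x', y). x' = x \<longrightarrow> y \<in> U) uniformity)"

instance
proof
  fix x y z :: circle
  show "dist x y = 0 \<longleftrightarrow> x = y"
  proof transfer
    fix a b :: real
    show "\<bar>(a - b) - of_int (round (a - b))\<bar> = 0 \<longleftrightarrow> a - b \<in> \<int>"
      by (metis Ints_cases Ints_of_int abs_eq_0 eq_iff_diff_eq_0 round_of_int)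
  qed
  show "dist x y \<le> dist x z + dist y z"
  proof transfer
    fix a b c :: real
    show "\<bar>(a - b) - of_int (round (a - b))\<bar> \<le>
      \<bar>(a - c) - of_int (round (a - c))\<bar> + \<bar>(b - c) - of_int (round (b - c))\<bar>"
      using dist_int_le[of "a - b" "round (a - c) - round (b - c)"] by simp
  qed
qed (simp_all add: uniformity_circle_def open_circle_def)

end

definition Leb :: "circle measure"
  where "Leb = distr (uniform_measure lborel {0..<1}) borel abs_circle"

text \<open>
  The projection is measurable, so the push-forward above is a genuine one,
  and the infinite product of copies of \<open>Leb\<close> below is a product of
  probability measures.
\<close>

lemma measurable_abs_circle: "abs_circle \<in> borel_measurable borel"
proof (rule borel_measurable_continuous_onI)
  have "dist (abs_circle x) (abs_circle y) \<le> dist x y" for x y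
    using dist_int_le[of "x - y" 0] by (simp add: dist_circle.abs_eq dist_real_def)
  then show "continuous_on UNIV abs_circle"
    unfolding continuous_on_iff by (meson le_less_trans)
qed

lemma prob_space_Leb: "prob_space Leb"
  unfolding Leb_def
proof (rule prob_space.prob_space_distr)
  show "prob_space (uniform_measure lborel {0..<1::real})"
    by (rule prob_space_uniform_measure) auto
  show "abs_circle \<in> uniform_measure lborel {0..<1} \<rightarrow>\<^sub>M borel"
    using measurable_abs_circle by (simp add: measurable_def)
qed

definition translation :: "circle \<Rightarrow> circle \<Rightarrow> circle"
  where "translation u x = x + u"

definition minimal :: "('a::topological_space \<Rightarrow> 'a) \<Rightarrow> bool"
  where "minimal T \<longleftrightarrow> (\<forall>x. closure (range (\<lambda>n. (T ^^ n) x)) = UNIV)"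

definition displacement :: "circle set \<Rightarrow> circle \<Rightarrow> real"
  where "displacement A \<epsilon> = measure Leb (sym_diff A (translation \<epsilon> ` A))"

definition no_translational_symmetries :: "circle set \<Rightarrow> bool"
  where "no_translational_symmetries A \<longleftrightarrow> (\<forall>\<epsilon>. displacement A \<epsilon> = 0 \<longleftrightarrow> \<epsilon> = 0)"

definition step :: "circle set \<Rightarrow> circle \<Rightarrow> circle \<Rightarrow> circle"
  where "step A v x = (if x \<in> A then x + v else x)"

definition random_step :: "circle set \<Rightarrow> circle \<Rightarrow> circle \<Rightarrow> circle \<Rightarrow> circle"
  where "random_step A v u = translation u \<circ> step A v"

text \<open>
  Sequences are indexed from \<open>0\<close>: the entry \<open>w n\<close> is the \<open>(n + 1)\<close>-st letter
  of the sequence.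
\<close>

primrec iteration ::
    "circle set \<Rightarrow> circle \<Rightarrow> (nat \<Rightarrow> circle) \<Rightarrow> nat \<Rightarrow> circle \<Rightarrow> circle"
  where
    "iteration A v w 0 = id"
  | "iteration A v w (Suc n) = random_step A v (w n) \<circ> iteration A v w n"

definition Omega :: "(nat \<Rightarrow> circle) measure"
  where "Omega = Pi\<^sub>M UNIV (\<lambda>_. Leb)"

end

theory Submission
  imports Defs
begin

text \<open>
  Let \<open>D\<close> be the difference of the two trajectories. The common translations make the first
  point uniformly distributed and independent of the past, so \<open>D\<close> is a lazy symmetric walk along the
  orbit of the rotation by \<open>v\<close> that moves by \<open>\<plusminus>v\<close> with probability \<open>\<phi>\<^sub>A(D)/2\<close> each: its generator is
  \<open>\<phi>\<^sub>A/2\<close> times the second difference \<open>\<Delta>h(d) = h(d + v) + h(d - v) - 2h(d)\<close>.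

  Since \<open>1/\<phi>\<^sub>A\<close> has infinite integral, for every \<open>\<eta>\<close> the function \<open>2\<eta>/max \<phi>\<^sub>A \<tau> - 2/c\<close>, where \<open>c\<close> is the
  minimum of \<open>\<phi>\<^sub>A\<close> at distance at least \<open>\<delta>\<close> from \<open>0\<close>, has positive integral for small \<open>\<tau>\<close>. Hence it
  dominates a trigonometric polynomial of mean zero, and such a polynomial is \<open>\<Delta>h\<close> for some
  continuous \<open>h\<close>, because \<open>v\<close> is irrational. The drift of \<open>h(D)\<close> is then at most
  \<open>\<eta> - 1[dist D 0 \<ge> \<delta>]\<close>. As \<open>h\<close> is bounded, an exponential moment bound and the Borel-Cantelli lemma
  show that the frequency of times with \<open>dist D 0 \<ge> \<delta>\<close> is almost surely asymptotically at most a
  constant times \<open>\<eta>\<close>. No recurrence argument is needed, and the walk may be absorbed at \<open>0\<close>.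
\<close>

subsection \<open>The circle as a compact group and its Haar measure\<close>

lemma abs_circle_add: "abs_circle (a + b) = abs_circle a + abs_circle b"
  by (simp add: plus_circle.abs_eq)

lemma dist_circle_diff: "dist x y = dist (x - y) (0::circle)"
  by transfer simp

lemma dist_circle_add_right [simp]: "dist (x + z) (y + z) = dist x (y::circle)"
  by (simp add: dist_circle_diff[of "x + z"] dist_circle_diff[of x])

lemma dist_circle_uminus [simp]: "dist (- x) (- y) = dist x (y::circle)"
  by (metis diff_minus_eq_add dist_circle_diff dist_commute uminus_add_conv_diff)

lemma continuous_on_abs_circle: "continuous_on S abs_circle"
proof -
  have "dist (abs_circle x) (abs_circle y) \<le> dist x y" for x y
    using dist_int_le[of "x - y" 0] by (simp add: dist_circle.abs_eq dist_real_def)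
  then show ?thesis
    unfolding continuous_on_iff by (meson le_less_trans)
qed

lemma ex_abs_circle: obtains t where "0 \<le> t" "t < 1" "x = abs_circle t"
proof -
  obtain s where s: "x = abs_circle s" by (metis Quotient_circle Quotient_abs_rep)
  have "abs_circle (frac s) = abs_circle s"
    by (simp add: circle.abs_eq_iff frac_def)
  then show ?thesis using that[of "frac s"] s by (simp add: frac_lt_1)
qed

lemma compact_circle: "compact (UNIV :: circle set)"
proof -
  have "abs_circle ` {0..1} = UNIV"
    by (auto simp: image_iff) (metis ex_abs_circle atLeastAtMost_iff less_eq_real_def)
  then show ?thesis
    using compact_continuous_image[OF continuous_on_abs_circle compact_Icc[of 0 1]] by simp
qed

instance circle :: topological_group_add
proof
  fix a b :: circle
  show "((\<lambda>x. fst x + snd x) \<longlongrightarrow> a + b) (nhds a \<times>\<^sub>F nhds b)"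
  proof (rule tendstoI)
    fix e :: real assume "e > 0"
    have "dist (x + y) (a + b) < e" if "dist x a < e / 2" "dist y b < e / 2" for x y
    proof -
      have "dist (x + y) (a + b) \<le> dist (x + y) (a + y) + dist (a + y) (a + b)"
        by (rule dist_triangle)
      also have "\<dots> = dist x a + dist y b"
        by (metis add.commute dist_circle_add_right)
      finally show ?thesis using that by simp
    qed
    moreover have "\<forall>\<^sub>F x in nhds a \<times>\<^sub>F nhds b. dist (fst x) a < e / 2 \<and> dist (snd x) b < e / 2"
      using \<open>e > 0\<close> unfolding eventually_prod_filter
      by (intro exI[of _ "\<lambda>x. dist x a < e / 2"] exI[of _ "\<lambda>x. dist x b < e / 2"])
        (auto simp: eventually_nhds_metric intro!: exI[of _ "e/2"])
    ultimately show "\<forall>\<^sub>F x in nhds a \<times>\<^sub>F nhds b. dist (fst x + snd x) (a + b) < e"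
      by (auto elim: eventually_mono)
  qed
  show "(uminus \<longlongrightarrow> - a) (nhds a)"
    by (rule tendstoI) (auto simp: eventually_nhds_metric)
qed

text \<open>Lets a compact set be separated from a disjoint closed one, and supplies the
  completeness that the next instance builds on.\<close>

instance circle :: heine_borel
proof
  fix f :: "nat \<Rightarrow> circle"
  show "\<exists>l r. strict_mono r \<and> (f \<circ> r) \<longlonglongrightarrow> l"
    using compact_circle unfolding compact_eq_seq_compact_metric seq_compact_def by auto
qed

text \<open>What remains is a countable base: balls with rational radii around images of rationals.
  Outer regularity of \<open>Leb\<close> and measurability of differences rest on it.\<close>

instance circle :: polish_space
proof
  define B where "B = (\<lambda>(q, r). ball (abs_circle (of_rat q)) (of_rat r)) ` (UNIV :: (rat \<times> rat) set)"
  have "topological_basis B"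
  proof (rule topological_basisI)
    fix U :: "circle set" and x assume "open U" "x \<in> U"
    then obtain e where e: "e > 0" "ball x e \<subseteq> U" by (meson openE)
    obtain r where r: "0 < real_of_rat r" "real_of_rat r < e / 2"
      using of_rat_dense[of 0 "e/2"] e by auto
    obtain t where t: "x = abs_circle t" by (meson ex_abs_circle)
    obtain q where q: "t < real_of_rat q" "real_of_rat q < t + of_rat r"
      using of_rat_dense[of t "t + of_rat r"] r by auto
    have d: "dist (abs_circle (of_rat q)) x < of_rat r"
      using dist_int_le[of "of_rat q - t" 0] q by (simp add: dist_circle.abs_eq t)
    have "ball (abs_circle (of_rat q)) (of_rat r) \<subseteq> ball x e"
    proof
      fix y assume "y \<in> ball (abs_circle (of_rat q)) (of_rat r)"
      then show "y \<in> ball x e"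
        using dist_triangle[of x y "abs_circle (of_rat q)"] d r by (simp add: dist_commute)
    qed
    with e d show "\<exists>b\<in>B. x \<in> b \<and> b \<subseteq> U"
      unfolding B_def by (intro bexI[of _ "ball (abs_circle (of_rat q)) (of_rat r)"]) auto
  qed (auto simp: B_def)
  moreover have "countable B" unfolding B_def by simp
  ultimately show "\<exists>B :: circle set set. countable B \<and> open = generate_topology B"
    by (metis topological_basis_imp_subbasis)
qed

section \<open>Lebesgue measure on the circle and its invariance\<close>

lemma sets_Leb [simp, measurable_cong]: "sets Leb = sets borel"
  by (simp add: Leb_def)

lemma space_Leb [simp]: "space Leb = UNIV"
  by (simp add: Leb_def)

interpretation Leb: prob_space Leb
  by (rule prob_space_Leb)

lemma emeasure_Leb:
  assumes "B \<in> sets borel"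
  shows "emeasure Leb B = emeasure lborel (abs_circle -` B \<inter> {0..<1})"
proof -
  have [measurable]: "abs_circle -` B \<in> sets borel"
    using measurable_sets[OF measurable_abs_circle assms] by simp
  have "abs_circle \<in> uniform_measure lborel {0..<1} \<rightarrow>\<^sub>M borel"
    using measurable_abs_circle by (simp add: measurable_def)
  then show ?thesis
    using assms by (simp add: Leb_def emeasure_distr Int_commute) (simp add: divide_ennreal_def)
qed

text \<open>On representatives, adding \<open>t\<close> replaces the window \<open>{0..<1}\<close>
  by \<open>{t..<t+1}\<close>; periodicity of the preimage of \<open>B\<close> moves the part beyond
  \<open>1\<close> back to \<open>{0..<t}\<close>.\<close>

lemma distr_Leb_add: "distr Leb borel (\<lambda>x. x + u) = Leb"
proof (rule measure_eqI)
  fix B assume "B \<in> sets (distr Leb borel (\<lambda>x. x + u))"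
  then have B [measurable]: "B \<in> sets borel" by simp
  obtain t where t: "0 \<le> t" "t < 1" "u = abs_circle t" by (meson ex_abs_circle)
  define S where "S = abs_circle -` B"
  have S [measurable]: "S \<in> sets borel"
    using measurable_sets[OF measurable_abs_circle B] by (simp add: S_def)
  have per: "x + 1 \<in> S \<longleftrightarrow> x \<in> S" for x
  proof -
    have "abs_circle (x + 1) = abs_circle x" by (simp add: circle.abs_eq_iff)
    then show ?thesis by (simp add: S_def)
  qed
  have shift: "emeasure lborel ((\<lambda>x. x + s) -` T) = emeasure lborel T" if "T \<in> sets borel" for s :: real and T
    using lborel_distr_plus[of s] emeasure_distr[of "(+) s" lborel borel T] that
    by (simp add: add.commute[of _ s])
  have "emeasure (distr Leb borel (\<lambda>x. x + u)) B = emeasure lborel (abs_circle -` ((\<lambda>x. x + u) -` B) \<inter> {0..<1})"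
    using emeasure_Leb[OF measurable_sets[of "\<lambda>x. x + u" borel borel B]] by (simp add: emeasure_distr)
  also have "abs_circle -` ((\<lambda>x. x + u) -` B) \<inter> {0..<1} = (\<lambda>x. x + t) -` (S \<inter> {t..<t+1})"
    by (auto simp: S_def abs_circle_add t)
  also have "emeasure lborel \<dots> = emeasure lborel (S \<inter> {t..<t+1})"
    by (rule shift) auto
  also have "S \<inter> {t..<t+1} = (S \<inter> {t..<1}) \<union> (S \<inter> {1..<t+1})"
    using t by auto
  also have "emeasure lborel \<dots> = emeasure lborel (S \<inter> {t..<1}) + emeasure lborel (S \<inter> {1..<t+1})"
    by (rule plus_emeasure[symmetric]) auto
  also have "emeasure lborel (S \<inter> {1..<t+1}) = emeasure lborel ((\<lambda>x. x + 1) -` (S \<inter> {1..<t+1}))"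
    by (rule shift[symmetric]) auto
  also have "(\<lambda>x. x + 1) -` (S \<inter> {1..<t+1}) = S \<inter> {0..<t}"
    by (auto simp: per)
  also have "emeasure lborel (S \<inter> {t..<1}) + emeasure lborel (S \<inter> {0..<t}) = emeasure lborel ((S \<inter> {t..<1}) \<union> (S \<inter> {0..<t}))"
    by (rule plus_emeasure) auto
  also have "(S \<inter> {t..<1}) \<union> (S \<inter> {0..<t}) = S \<inter> {0..<1}"
    using t by auto
  also have "emeasure lborel \<dots> = emeasure Leb B"
    by (simp add: emeasure_Leb S_def)
  finally show "emeasure (distr Leb borel (\<lambda>x. x + u)) B = emeasure Leb B" .
qed simp

lemma integral_Leb_add:
  fixes f :: "circle \<Rightarrow> real"
  assumes "f \<in> borel_measurable borel"
  shows "(\<integral>x. f (x + u) \<partial>Leb) = (\<integral>x. f x \<partial>Leb)"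
  using assms integral_distr[of "\<lambda>x. x + u" Leb borel f] by (simp add: distr_Leb_add)

lemma measure_Leb_add:
  assumes "B \<in> sets borel"
  shows "measure Leb ((\<lambda>x. x + u) -` B) = measure Leb B"
  using assms measure_distr[of "\<lambda>x. x + u" Leb borel B] by (simp add: distr_Leb_add)

subsection \<open>Continuity of the displacement function\<close>

lemma translation_image: "translation \<epsilon> ` A = (\<lambda>x. x + (- \<epsilon>)) -` A"
  by (auto simp: translation_def image_iff intro!: bexI[of _ "x - \<epsilon>" for x])

lemma measurable_circle_add [measurable]: "(\<lambda>x. x + (u::circle)) \<in> borel_measurable borel"
  by (intro borel_measurable_continuous_onI continuous_intros)

lemma borel_measurable_circle_diff [measurable]:
  fixes f g :: "'a \<Rightarrow> circle"
  assumes "f \<in> borel_measurable M" "g \<in> borel_measurable M"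
  shows "(\<lambda>x. f x - g x) \<in> borel_measurable M"
  by (rule borel_measurable_continuous_Pair[OF assms, of "\<lambda>a b. a - b"]) (intro continuous_intros)

lemma sets_vimage_add: "B \<in> sets borel \<Longrightarrow> (\<lambda>x. x + (u::circle)) -` B \<in> sets borel"
  using measurable_sets_borel[of "\<lambda>x. x + u" borel B] by simp

lemma displacement_nonneg [simp]: "displacement A d \<ge> 0"
  by (simp add: displacement_def)

context
  fixes A :: "circle set"
  assumes A [measurable]: "A \<in> sets borel"
begin

text \<open>Invariance of \<open>Leb\<close> trades the translate of \<open>A\<close> for a
  condition on \<open>x\<close> and \<open>x + d\<close>, which is how two points with difference
  \<open>d\<close> meet \<open>A\<close>.\<close>

lemma displacement_eq: "displacement A d = measure Leb {x. (x \<in> A) \<noteq> (x + d \<in> A)}"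
proof -
  have *: "{x. (x \<in> A) \<noteq> (x + (- d) \<in> A)} \<in> sets borel" by measurable
  have "sym_diff A (translation d ` A) = {x. (x \<in> A) \<noteq> (x + (- d) \<in> A)}"
    unfolding translation_image by auto
  moreover have "(\<lambda>x. x + d) -` {x. (x \<in> A) \<noteq> (x + (- d) \<in> A)} = {x. (x \<in> A) \<noteq> (x + d \<in> A)}"
    by auto
  ultimately show ?thesis
    unfolding displacement_def using measure_Leb_add[of "{x. (x \<in> A) \<noteq> (x + (- d) \<in> A)}" d] *
    by simp
qed

lemma displacement_uminus: "displacement A (- d) = displacement A d"
proof -
  have *: "{x. (x \<in> A) \<noteq> (x + (- d) \<in> A)} \<in> sets borel" by measurable
  have "(\<lambda>x. x + d) -` {x. (x \<in> A) \<noteq> (x + (- d) \<in> A)} = {x. (x \<in> A) \<noteq> (x + d \<in> A)}"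
    by auto
  then show ?thesis
    unfolding displacement_eq using measure_Leb_add[of "{x. (x \<in> A) \<noteq> (x + (- d) \<in> A)}" d] *
    by simp
qed

text \<open>If membership changes between \<open>x\<close> and \<open>x + d + e\<close>, it changes
  before or after \<open>x + d\<close>. This reduces continuity to continuity at
  \<open>0\<close>.\<close>

lemma displacement_add_le: "displacement A (d + e) \<le> displacement A d + displacement A e"
proof -
  let ?E = "{x. (x \<in> A) \<noteq> (x + e \<in> A)}"
  have "displacement A (d + e) \<le> measure Leb ({x. (x \<in> A) \<noteq> (x + d \<in> A)} \<union> (\<lambda>x. x + d) -` ?E)"
    unfolding displacement_eq
    by (rule Leb.finite_measure_mono) (auto simp: add.assoc measurable_sets_borel[of "\<lambda>x. x + d" borel])
  also have "\<dots> \<le> measure Leb {x. (x \<in> A) \<noteq> (x + d \<in> A)} + measure Leb ((\<lambda>x. x + d) -` ?E)"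
    by (rule measure_Un_le) (auto simp: sets_vimage_add)
  also have "measure Leb ((\<lambda>x. x + d) -` ?E) = measure Leb ?E"
    by (rule measure_Leb_add) simp
  finally show ?thesis by (simp add: displacement_eq)
qed

text \<open>A set agrees, up to small measure, with a compact subset and with an open superset, and a small
  translation maps the former into the latter.\<close>

lemma displacement_small:
  assumes "e > 0"
  obtains \<eta> where "\<eta> > 0" "\<And>d. dist d 0 < \<eta> \<Longrightarrow> displacement A d < e"
proof -
  have outer: "\<exists>U. open U \<and> B \<subseteq> U \<and> measure Leb (U - B) < e / 4" if B: "B \<in> sets borel" for B
  proof -
    have "\<exists>U. open U \<and> B \<subseteq> U \<and> emeasure Leb U < emeasure Leb B + ennreal (e / 4)"
    proof (rule ccontr)
      assume *: "\<not> ?thesis"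
      have "emeasure Leb B = (INF U\<in>{U. B \<subseteq> U \<and> open U}. emeasure Leb U)"
        using B by (intro outer_regular) auto
      moreover have "emeasure Leb B + ennreal (e / 4) \<le> \<dots>"
        using * by (intro INF_greatest) (auto simp: not_less)
      ultimately have "emeasure Leb B + ennreal (e / 4) \<le> emeasure Leb B"
        by simp
      then show False
        using assms by (simp add: Leb.emeasure_eq_measure flip: ennreal_plus)
    qed
    then obtain U where "open U" "B \<subseteq> U" "measure Leb U < measure Leb B + e / 4"
      using assms by (auto simp: Leb.emeasure_eq_measure ennreal_less_iff simp flip: ennreal_plus)
    then show ?thesis
      using B by (intro exI[of _ U]) (auto simp: Leb.finite_measure_Diff)
  qed
  obtain U where U: "open U" "A \<subseteq> U" "measure Leb (U - A) < e / 4"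
    using outer[OF A] by blast
  \<comment> \<open>Outer regularity of the complement gives the inner approximation:
    \<open>- V\<close> is closed, hence compact, and contained in \<open>A\<close>.\<close>
  obtain V where V: "open V" "- A \<subseteq> V" "measure Leb (V - (- A)) < e / 4"
    using outer[of "- A"] A by (auto simp: borel_comp)
  define K where "K = - V"
  have K: "compact K" "K \<subseteq> A"
    using V compact_Int_closed[OF compact_circle, of K] by (auto simp: K_def)
  have [simp]: "A \<in> sets borel" "K \<in> sets borel" "U \<in> sets borel"
    using A U V by (auto simp: K_def borel_comp)
  have "V - (- A) = A - K" by (auto simp: K_def)
  with U V have AK: "measure Leb (A - K) < e / 4" "measure Leb (U - A) < e / 4"
    by simp_all
  obtain \<eta> where \<eta>: "\<eta> > 0" "\<And>x y. x \<in> K \<Longrightarrow> y \<in> - U \<Longrightarrow> \<eta> \<le> dist x y"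
    using separate_compact_closed[of K "- U"] K U by (metis closed_Compl disjoint_eq_subset_Compl double_compl subset_trans)
  show ?thesis
  proof (rule that[OF \<eta>(1)])
    fix d :: circle assume d: "dist d 0 < \<eta>"
    have near: "dist x (x + d) < \<eta>" for x
      using d by (metis add.commute add.left_neutral dist_circle_add_right dist_commute)
    have UA: "U - A \<in> sets borel" and AK_sets: "A - K \<in> sets borel"
      using A U(1) V(1) by (auto simp: K_def)
    let ?T = "\<lambda>B. (\<lambda>x. x + d) -` B"
    \<comment> \<open>One of \<open>x\<close> and \<open>x + d\<close> lies in \<open>A\<close>.
      Either it is in \<open>A - K\<close>, or it is in \<open>K\<close>, and then the other one is
      still in \<open>U\<close>, hence in \<open>U - A\<close>.\<close>
    have "x \<in> (A - K) \<union> ?T (U - A) \<union> ?T (A - K) \<union> (U - A)" if "(x \<in> A) \<noteq> (x + d \<in> A)" for x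
      using \<eta>(2)[of x "x + d"] \<eta>(2)[of "x + d" x] near[of x] that by (auto simp: dist_commute)
    then have "displacement A d \<le> measure Leb ((A - K) \<union> ?T (U - A) \<union> ?T (A - K) \<union> (U - A))"
      unfolding displacement_eq
      by (intro Leb.finite_measure_mono subsetI)
        (simp, unfold sets_Leb, intro sets.Un sets_vimage_add UA AK_sets)
    also have "\<dots> \<le> measure Leb (A - K) + measure Leb (?T (U - A)) + measure Leb (?T (A - K)) + measure Leb (U - A)"
      by (intro order.trans[OF measure_Un_le] add_mono order.refl; unfold sets_Leb)
        (intro sets.Un sets_vimage_add UA AK_sets)+
    also have "measure Leb (?T (U - A)) = measure Leb (U - A)"
      by (rule measure_Leb_add[OF UA])
    also have "measure Leb (?T (A - K)) = measure Leb (A - K)"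
      by (rule measure_Leb_add[OF AK_sets])
    finally show "displacement A d < e" using AK by linarith
  qed
qed

text \<open>Subadditivity and evenness bound the oscillation between two points by the displacement
  at their difference, which is small near \<open>0\<close>.\<close>

lemma continuous_on_displacement: "continuous_on UNIV (displacement A)"
proof -
  have le: "displacement A x - displacement A y \<le> displacement A (x - y)" for x y
    using displacement_add_le[of y "x - y"] by simp
  have abs_le: "\<bar>displacement A x - displacement A y\<bar> \<le> displacement A (x - y)" for x y
    using le[of x y] le[of y x] displacement_uminus[of "x - y"] by simp
  show ?thesis
    unfolding continuous_on_iff
  proof safe
    fix x :: circle and e :: real assume "e > 0"
    then obtain \<eta> where \<eta>: "\<eta> > 0" "\<And>d. dist d 0 < \<eta> \<Longrightarrow> displacement A d < e"
      using displacement_small by blast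
    have "dist (displacement A y) (displacement A x) < e" if "dist y x < \<eta>" for y
      using abs_le[of y x] \<eta>(2)[of "y - x"] that by (simp add: dist_real_def dist_circle_diff[of y x])
    then show "\<exists>d>0. \<forall>x'\<in>UNIV. dist x' x < d \<longrightarrow> dist (displacement A x') (displacement A x) < e"
      using \<eta>(1) by blast
  qed
qed

text \<open>\<open>A\<close> and its translate have equal measure, so points entering and points
  leaving \<open>A\<close> share the displacement equally. This is why the difference walk is
  symmetric.\<close>

lemma measure_enter: "measure Leb {x. x \<notin> A \<and> x + d \<in> A} = displacement A d / 2"
  and measure_leave: "measure Leb {x. x \<in> A \<and> x + d \<notin> A} = displacement A d / 2"
proof -
  let ?P = "{x. x \<notin> A \<and> x + d \<in> A}" and ?M = "{x. x \<in> A \<and> x + d \<notin> A}" and ?I = "{x. x \<in> A \<and> x + d \<in> A}"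
  have 1: "measure Leb (?P \<union> ?I) = measure Leb ?P + measure Leb ?I"
    by (rule Leb.finite_measure_Union) auto
  have 2: "measure Leb (?M \<union> ?I) = measure Leb ?M + measure Leb ?I"
    by (rule Leb.finite_measure_Union) auto
  have 3: "measure Leb (?P \<union> ?M) = measure Leb ?P + measure Leb ?M"
    by (rule Leb.finite_measure_Union) auto
  have "?P \<union> ?I = (\<lambda>x. x + d) -` A" "?M \<union> ?I = A" "?P \<union> ?M = {x. (x \<in> A) \<noteq> (x + d \<in> A)}"
    by auto
  then show "measure Leb ?P = displacement A d / 2" "measure Leb ?M = displacement A d / 2"
    using 1 2 3 measure_Leb_add[of A d] by (simp_all add: displacement_eq)
qed

end

subsection \<open>Trigonometric polynomials and second differences\<close>

text \<open>The phase makes sines available too, so this one family spans the real trigonometric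
  polynomials.\<close>

lift_definition circle_cos :: "int \<Rightarrow> real \<Rightarrow> circle \<Rightarrow> real"
  is "\<lambda>k \<theta> x. cos (2 * pi * of_int k * x + \<theta>)"
proof -
  fix k \<theta> and a b :: real assume "a - b \<in> \<int>"
  then obtain n where n: "a = b + of_int n"
    by (metis Ints_cases add.commute diff_add_cancel)
  have "cos (2 * pi * of_int k * a + \<theta>) = cos ((2 * pi * of_int k * b + \<theta>) + 2 * pi * of_int (k * n))"
    by (simp add: n algebra_simps)
  also have "\<dots> = cos (2 * pi * of_int k * b + \<theta>)"
    by (subst cos_add) (simp only: cos_int_2pin sin_int_2pin mult_1_right mult_zero_right diff_zero)
  finally show "cos (2 * pi * of_int k * a + \<theta>) = cos (2 * pi * of_int k * b + \<theta>)" .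
qed

lemma cos_lipschitz: "\<bar>cos a - cos b\<bar> \<le> \<bar>a - b\<bar>" for a b :: real
proof -
  have "\<bar>cos a - cos b\<bar> = 2 * \<bar>sin ((a + b) / 2)\<bar> * \<bar>sin ((b - a) / 2)\<bar>"
    by (simp add: cos_diff_cos abs_mult)
  also have "\<dots> \<le> 2 * 1 * \<bar>(b - a) / 2\<bar>"
    by (intro mult_mono abs_sin_x_le_abs_x) auto
  finally show ?thesis by simp
qed

lemma continuous_on_circle_cos: "continuous_on UNIV (circle_cos k \<theta>)"
proof -
  have "\<bar>circle_cos k \<theta> x - circle_cos k \<theta> y\<bar> \<le> 2 * pi * \<bar>of_int k\<bar> * dist x y" for x y
  proof transfer
    fix k \<theta> and x y :: real
    \<comment> \<open>Removing the nearest integer leaves the cosine unchanged and turns the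
      Lipschitz bound on the line into one for the circle distance.\<close>
    define n where "n = round (x - y)"
    have "cos (2 * pi * of_int k * x + \<theta>) = cos ((2 * pi * of_int k * (x - of_int n) + \<theta>) + 2 * pi * of_int (k * n))"
      by (simp add: algebra_simps)
    also have "\<dots> = cos (2 * pi * of_int k * (x - of_int n) + \<theta>)"
      by (subst cos_add) (simp only: cos_int_2pin sin_int_2pin mult_1_right mult_zero_right diff_zero)
    finally have "\<bar>cos (2 * pi * of_int k * x + \<theta>) - cos (2 * pi * of_int k * y + \<theta>)\<bar>
      \<le> \<bar>(2 * pi * of_int k * (x - of_int n) + \<theta>) - (2 * pi * of_int k * y + \<theta>)\<bar>"
      by (simp only: cos_lipschitz)
    also have "\<dots> = \<bar>2 * pi * of_int k * (x - y - of_int n)\<bar>"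
      by (simp add: algebra_simps)
    also have "\<dots> = 2 * pi * \<bar>of_int k\<bar> * \<bar>x - y - of_int n\<bar>"
      by (simp add: abs_mult)
    finally show "\<bar>cos (2 * pi * of_int k * x + \<theta>) - cos (2 * pi * of_int k * y + \<theta>)\<bar>
      \<le> 2 * pi * \<bar>of_int k\<bar> * \<bar>x - y - of_int (round (x - y))\<bar>" by (simp add: n_def)
  qed
  then have "(2 * pi * \<bar>of_int k\<bar>)-lipschitz_on UNIV (circle_cos k \<theta>)"
    by (intro lipschitz_onI) (auto simp: dist_real_def)
  then show ?thesis by (rule lipschitz_on_continuous_on)
qed

inductive trig_poly :: "(circle \<Rightarrow> real) \<Rightarrow> bool" where
  monomial: "trig_poly (\<lambda>x. a * circle_cos k \<theta> x)"
| sum: "trig_poly p \<Longrightarrow> trig_poly q \<Longrightarrow> trig_poly (\<lambda>x. p x + q x)"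

lemma trig_poly_continuous: "trig_poly p \<Longrightarrow> continuous_on UNIV p"
  by (induction rule: trig_poly.induct) (intro continuous_intros continuous_on_circle_cos | assumption)+

lemma circle_cos_mult:
  "circle_cos k \<theta> x * circle_cos l \<eta> x =
     circle_cos (k - l) (\<theta> - \<eta>) x / 2 + circle_cos (k + l) (\<theta> + \<eta>) x / 2"
  by transfer (simp add: cos_times_cos algebra_simps add_divide_distrib)

lemma trig_poly_mult:
  assumes "trig_poly p" "trig_poly q"
  shows "trig_poly (\<lambda>x. p x * q x)"
  using assms
proof (induction rule: trig_poly.induct)
  case (monomial a k \<theta>)
  from monomial show ?case
  proof (induction rule: trig_poly.induct)
    case (monomial b l \<eta>)
    have "(\<lambda>x. a * circle_cos k \<theta> x * (b * circle_cos l \<eta> x)) =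
      (\<lambda>x. (a * b / 2) * circle_cos (k - l) (\<theta> - \<eta>) x + (a * b / 2) * circle_cos (k + l) (\<theta> + \<eta>) x)"
    proof
      fix x
      have "a * circle_cos k \<theta> x * (b * circle_cos l \<eta> x) = a * b * (circle_cos k \<theta> x * circle_cos l \<eta> x)"
        by simp
      also have "\<dots> = (a * b / 2) * circle_cos (k - l) (\<theta> - \<eta>) x + (a * b / 2) * circle_cos (k + l) (\<theta> + \<eta>) x"
        unfolding circle_cos_mult by (simp add: algebra_simps)
      finally show "a * circle_cos k \<theta> x * (b * circle_cos l \<eta> x) = \<dots>" .
    qed
    then show ?case by (metis trig_poly.intros)
  next
    case (sum p q)
    then show ?case by (simp add: distrib_left trig_poly.sum)
  qed
next
  case (sum p q)
  then show ?case by (simp add: distrib_right trig_poly.sum)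
qed

lemma trig_poly_const: "trig_poly (\<lambda>_. c)"
proof -
  have "circle_cos 0 0 x = 1" for x by transfer simp
  then show ?thesis using trig_poly.monomial[of c 0 0] by simp
qed

lemma circle_cos_separates:
  assumes "x \<noteq> y"
  shows "\<exists>\<theta>. circle_cos 1 \<theta> x \<noteq> circle_cos 1 \<theta> y"
  using assms
proof transfer
  fix x y :: real assume nI: "x - y \<notin> \<int>"
  have "cos (2 * pi * (y - x)) \<noteq> 1"
  proof
    assume "cos (2 * pi * (y - x)) = 1"
    then obtain n where "2 * pi * (y - x) = of_int n * 2 * pi" by (auto simp: cos_one_2pi_int)
    then have "(y - x) * (2 * pi) = of_int n * (2 * pi)" by (simp only: mult_ac)
    then have "x - y = of_int (- n)" by (subst (asm) mult_cancel_right) simp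
    then show False using nI by (metis Ints_of_int)
  qed
  then show "\<exists>\<theta>. cos (2 * pi * of_int 1 * x + \<theta>) \<noteq> cos (2 * pi * of_int 1 * y + \<theta>)"
    \<comment> \<open>This phase gives the value \<open>1\<close> at \<open>x\<close>, which
      \<open>y\<close> could share only if \<open>y - x\<close> were an integer.\<close>
    by (intro exI[of _ "- (2 * pi * x)"]) (simp add: right_diff_distrib)
qed

text \<open>Makes Stone-Weierstrass available: trigonometric polynomials are uniformly dense in the
  continuous functions.\<close>

interpretation trig: function_ring_on "Collect trig_poly" UNIV
proof
  fix x y :: circle assume "x \<noteq> y"
  then obtain \<theta> where "circle_cos 1 \<theta> x \<noteq> circle_cos 1 \<theta> y" using circle_cos_separates by blast
  then show "\<exists>f\<in>Collect trig_poly. f x \<noteq> f y"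
    using trig_poly.monomial[of 1 1 \<theta>] by (intro bexI[of _ "\<lambda>x. 1 * circle_cos 1 \<theta> x"]) auto
qed (auto simp: compact_circle trig_poly_continuous trig_poly.sum trig_poly_mult trig_poly_const)

section \<open>Second differences along the rotation\<close>

definition second_diff :: "circle \<Rightarrow> (circle \<Rightarrow> real) \<Rightarrow> circle \<Rightarrow> real"
  where "second_diff v h x = h (x + v) + h (x - v) - 2 * h x"

text \<open>Monomials are eigenfunctions, so equations for second differences can be solved one
  frequency at a time.\<close>

lemma second_diff_circle_cos:
  "second_diff v (circle_cos k \<theta>) x = (2 * circle_cos k 0 v - 2) * circle_cos k \<theta> x"
  unfolding second_diff_def
proof transfer
  fix v x :: real and k \<theta>
  let ?a = "2 * pi * of_int k * x + \<theta>" and ?b = "2 * pi * of_int k * v"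
  have "cos (?a + ?b) + cos (?a - ?b) = 2 * cos ?b * cos ?a"
    by (simp add: cos_add cos_diff)
  then show "cos (2 * pi * of_int k * (x + v) + \<theta>) + cos (2 * pi * of_int k * (x - v) + \<theta>) -
      2 * cos (2 * pi * of_int k * x + \<theta>) = (2 * cos (2 * pi * of_int k * v + 0) - 2) * cos (2 * pi * of_int k * x + \<theta>)"
    by (simp add: algebra_simps)
qed

text \<open>Otherwise the closed level set of the value \<open>1\<close> would contain the orbit of
  \<open>0\<close>, hence the whole circle; but at \<open>1 / (2 * k)\<close> the value is
  \<open>-1\<close>.\<close>

lemma minimal_circle_cos_neq_1:
  assumes "minimal (translation v)" "k \<noteq> 0"
  shows "circle_cos k 0 v \<noteq> 1"
proof
  assume eq: "circle_cos k 0 v = 1"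
  have inv: "circle_cos k 0 ((translation v ^^ n) 0) = 1" for n
  proof (induction n)
    case 0
    show ?case by simp (transfer, simp)
  next
    case (Suc n)
    have "circle_cos k 0 x = 1 \<Longrightarrow> circle_cos k 0 v = 1 \<Longrightarrow> circle_cos k 0 (x + v) = 1" for x
      by transfer (simp add: distrib_left cos_add cos_one_sin_zero)
    with Suc eq show ?case by (simp add: translation_def)
  qed
  have "closed {x. circle_cos k 0 x = 1}"
    by (intro closed_Collect_eq continuous_on_circle_cos continuous_on_const)
  then have "closure (range (\<lambda>n. (translation v ^^ n) 0)) \<subseteq> {x. circle_cos k 0 x = 1}"
    using inv by (intro closure_minimal) auto
  then have "circle_cos k 0 x = 1" for x
    using assms unfolding minimal_def by auto
  from this[of "abs_circle (1 / (2 * of_int k))"] show False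
    using assms(2) by (simp add: circle_cos.abs_eq)
qed

lemma second_diff_add: "second_diff v (\<lambda>x. h x + g x) x = second_diff v h x + second_diff v g x"
  by (simp add: second_diff_def)

lemma second_diff_cmult: "second_diff v (\<lambda>x. c * h x) x = c * second_diff v h x"
  by (simp add: second_diff_def algebra_simps)

text \<open>Each nonzero frequency is divided by its eigenvalue, and frequency \<open>0\<close> goes
  into \<open>m\<close>. The sum is finite, so small eigenvalues do no harm.\<close>

lemma trig_poly_solve:
  assumes "trig_poly p" "minimal (translation v)"
  shows "\<exists>h m. continuous_on UNIV h \<and> (\<forall>x. p x = m + second_diff v h x)"
  using assms(1)
proof (induction rule: trig_poly.induct)
  case (monomial a k \<theta>)
  show ?case
  proof (cases "k = 0")
    case True
    have "circle_cos 0 \<theta> x = cos \<theta>" for x by transfer simp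
    then show ?thesis
      using True by (intro exI[of _ "\<lambda>_. 0"] exI[of _ "a * cos \<theta>"]) (simp add: second_diff_def)
  next
    case False
    define c where "c = 2 * circle_cos k 0 v - 2"
    have c: "c \<noteq> 0" using minimal_circle_cos_neq_1[OF assms(2) False] by (simp add: c_def)
    have "a * circle_cos k \<theta> x = 0 + second_diff v (\<lambda>x. (a / c) * circle_cos k \<theta> x) x" for x
      unfolding second_diff_cmult second_diff_circle_cos using c by (simp add: c_def)
    moreover have "continuous_on UNIV (\<lambda>x. (a / c) * circle_cos k \<theta> x)"
      by (intro continuous_intros continuous_on_circle_cos)
    ultimately show ?thesis by blast
  qed
next
  case (sum p q)
  then obtain h m g n where "continuous_on UNIV h" "\<forall>x. p x = m + second_diff v h x"
    "continuous_on UNIV g" "\<forall>x. q x = n + second_diff v g x" by blast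
  then show ?case
    by (intro exI[of _ "\<lambda>x. h x + g x"] exI[of _ "m + n"])
       (auto simp: second_diff_add intro: continuous_intros)
qed

lemma continuous_circle_measurable:
  fixes h :: "circle \<Rightarrow> real"
  shows "continuous_on UNIV h \<Longrightarrow> h \<in> borel_measurable borel"
  by (rule borel_measurable_continuous_onI)

lemma continuous_circle_bounded:
  fixes h :: "circle \<Rightarrow> real"
  assumes "continuous_on UNIV h"
  obtains B where "B > 0" "\<And>x. \<bar>h x\<bar> \<le> B"
proof -
  have "bounded (range h)"
    using compact_continuous_image[OF assms compact_circle] by (rule compact_imp_bounded)
  then show ?thesis using that by (auto simp: bounded_pos)
qed

lemma continuous_circle_integrable:
  fixes h :: "circle \<Rightarrow> real"
  assumes "continuous_on UNIV h"
  shows "integrable Leb h"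
proof -
  obtain B where "\<And>x. \<bar>h x\<bar> \<le> B" using continuous_circle_bounded[OF assms] by metis
  then show ?thesis
    using continuous_circle_measurable[OF assms] by (intro Leb.integrable_const_bound[of _ B]) auto
qed

lemma integral_second_diff:
  assumes "continuous_on UNIV h"
  shows "(\<integral>x. second_diff v h x \<partial>Leb) = 0"
proof -
  have m: "h \<in> borel_measurable borel" by (rule continuous_circle_measurable[OF assms])
  have i: "integrable Leb (\<lambda>x. h (x + u))" for u
    by (intro continuous_circle_integrable continuous_on_compose2[OF assms] continuous_intros) auto
  have "(\<integral>x. second_diff v h x \<partial>Leb) = (\<integral>x. h (x + v) + h (x + (- v)) - 2 * h (x + 0) \<partial>Leb)"
    by (simp add: second_diff_def)
  also have "\<dots> = (\<integral>x. h (x + v) \<partial>Leb) + (\<integral>x. h (x + (- v)) \<partial>Leb) - 2 * (\<integral>x. h (x + 0) \<partial>Leb)"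
    using i by (simp del: add_0_right add_uminus_conv_diff)
  also have "\<dots> = 0"
    using integral_Leb_add[OF m, of v] integral_Leb_add[OF m, of "- v"] by simp
  finally show ?thesis .
qed

lemma second_diff_minorant:
  assumes g: "continuous_on UNIV g" and pos: "(\<integral>x. g x \<partial>Leb) > 0" and min: "minimal (translation v)"
  obtains h where "continuous_on UNIV h" "\<And>x. second_diff v h x \<le> g x"
proof -
  define s where "s = (\<integral>x. g x \<partial>Leb) / 2"
  have s: "s > 0" using pos by (simp add: s_def)
  have "continuous_on UNIV (\<lambda>x. g x - s)" using g by (intro continuous_intros)
  from trig.Stone_Weierstrass_basic[OF this s] obtain p where
    p: "trig_poly p" "\<And>x. \<bar>g x - s - p x\<bar> < s" by auto
  obtain h m where h: "continuous_on UNIV h" "\<And>x. p x = m + second_diff v h x"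
    using trig_poly_solve[OF p(1) min] by blast
  have "0 = (\<integral>x. g x - 2 * s \<partial>Leb)"
    using continuous_circle_integrable[OF g] by (simp add: s_def Leb.prob_space[simplified])
  also have "\<dots> \<le> (\<integral>x. p x \<partial>Leb)"
  proof (rule integral_mono)
    show "g x - 2 * s \<le> p x" for x using p(2)[of x] by linarith
  qed (use continuous_circle_integrable[OF g] continuous_circle_integrable[OF trig_poly_continuous[OF p(1)]] in auto)
  also have "\<dots> = m"
  proof -
    have "continuous_on UNIV (second_diff v h)"
      unfolding second_diff_def by (intro continuous_intros continuous_on_compose2[OF h(1)]) auto
    from continuous_circle_integrable[OF this] show ?thesis
      by (simp add: h(2) integral_second_diff[OF h(1)] Leb.prob_space[simplified])
  qed
  finally have "m \<ge> 0" .
  then have "second_diff v h x \<le> g x" for x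
    using p(2)[of x] h(2)[of x] by linarith
  with h(1) show ?thesis by (rule that)
qed

subsection \<open>Exponential moments along the random iterations\<close>

interpretation seq: sequence_space Leb
  by unfold_locales

lemma sets_Omega [measurable_cong]: "sets Omega = sets (\<Pi>\<^sub>M i\<in>UNIV. borel)"
  unfolding Omega_def by (rule sets_PiM_cong) simp_all

interpretation Omega: prob_space Omega
  unfolding Omega_def by unfold_locales

text \<open>Prepending an independent uniform letter preserves \<open>Omega\<close>, so the first
  letter can be integrated separately.\<close>

lemma nn_integral_Omega:
  assumes [measurable]: "F \<in> borel_measurable Omega"
  shows "(\<integral>\<^sup>+w. F w \<partial>Omega) = (\<integral>\<^sup>+u. \<integral>\<^sup>+w. F (case_nat u w) \<partial>Omega \<partial>Leb)"
proof -
  have F: "F \<in> borel_measurable (\<Pi>\<^sub>M i\<in>UNIV. Leb)"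
    using assms by (simp add: Omega_def)
  have "(\<integral>\<^sup>+w. F w \<partial>Omega) = (\<integral>\<^sup>+w. F w \<partial>distr (Leb \<Otimes>\<^sub>M (\<Pi>\<^sub>M i\<in>UNIV. Leb)) (\<Pi>\<^sub>M i\<in>UNIV. Leb) (\<lambda>(s, \<omega>). case_nat s \<omega>))"
    unfolding Omega_def seq.PiM_iter ..
  also have "\<dots> = (\<integral>\<^sup>+p. F (case_nat (fst p) (snd p)) \<partial>(Leb \<Otimes>\<^sub>M (\<Pi>\<^sub>M i\<in>UNIV. Leb)))"
    by (subst nn_integral_distr) (use F in \<open>auto simp: case_prod_beta\<close>)
  also have "\<dots> = (\<integral>\<^sup>+u. \<integral>\<^sup>+w. F (case_nat u w) \<partial>Omega \<partial>Leb)"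
    unfolding Omega_def using F by (subst seq.nn_integral_fst[symmetric]) auto
  finally show ?thesis .
qed

lemma iteration_case_nat:
  "iteration A v (case_nat u w) (Suc n) x = iteration A v w n (random_step A v u x)"
  by (induction n) simp_all

text \<open>The linear coefficient is exactly \<open>1\<close>, so a nonpositive mean of
  \<open>z\<close> can be exploited after integration.\<close>

lemma exp_le_quadratic:
  fixes z :: real
  assumes "\<bar>z\<bar> \<le> 1"
  shows "exp z \<le> 1 + z + z\<^sup>2"
proof (cases "z \<ge> 0")
  case True
  then show ?thesis using assms by (intro exp_bound) auto
next
  case False
  define y where "y = - z"
  have y: "y > 0" using False by (simp add: y_def)
  \<comment> \<open>For negative \<open>z\<close> the claim is multiplied by \<open>exp y\<close>,
    and \<open>exp y\<close> is replaced by its quadratic Taylor minorant.\<close>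
  have "1 \<le> (1 - y + y\<^sup>2) * (1 + y + y\<^sup>2 / 2)"
  proof -
    have "(1 - y + y\<^sup>2) * (1 + y + y\<^sup>2 / 2) = 1 + y\<^sup>2 / 2 + y ^ 3 / 2 + y ^ 4 / 2"
      by (simp add: field_simps power2_eq_square power3_eq_cube power4_eq_xxxx)
    then show ?thesis using y by simp
  qed
  also have "\<dots> \<le> (1 - y + y\<^sup>2) * exp y"
  proof (rule mult_left_mono)
    show "1 + y + y\<^sup>2 / 2 \<le> exp y" using exp_lower_Taylor_quadratic[of y] y by simp
    have "0 \<le> (1 - y / 2)\<^sup>2 + 3 / 4 * y\<^sup>2" by simp
    then show "0 \<le> 1 - y + y\<^sup>2" by (simp add: power2_eq_square algebra_simps)
  qed
  finally have "exp (- y) \<le> 1 - y + y\<^sup>2"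
    by (simp add: exp_minus field_simps)
  then show ?thesis by (simp add: y_def)
qed

text \<open>The sum starts at \<open>1\<close>: only after the first letter is the pair a common
  uniform translate, the form for which a drift bound is available.\<close>

definition path_sum ::
    "circle set \<Rightarrow> circle \<Rightarrow> (circle \<Rightarrow> circle \<Rightarrow> real) \<Rightarrow> (nat \<Rightarrow> circle) \<Rightarrow> nat \<Rightarrow> circle \<Rightarrow> circle \<Rightarrow> real"
  where "path_sum A v \<psi> w n x y = (\<Sum>j=1..n. \<psi> (iteration A v w j x) (iteration A v w j y))"

context
  fixes A :: "circle set" and v :: circle
  assumes A [measurable]: "A \<in> sets borel"
begin

lemma measurable_step [measurable]: "step A v \<in> borel_measurable borel"
  unfolding step_def[abs_def] by measurable

lemma measurable_iteration [measurable]: "(\<lambda>w. iteration A v w n x) \<in> borel_measurable Omega"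
proof (induction n)
  case (Suc n)
  then show ?case by (simp add: random_step_def translation_def)
qed simp

context
  fixes \<psi> :: "circle \<Rightarrow> circle \<Rightarrow> real" and B :: real
  assumes psi [measurable]: "(\<lambda>(x, y). \<psi> x y) \<in> borel_measurable (borel \<Otimes>\<^sub>M borel)"
    and bound: "\<And>x y. \<bar>\<psi> x y\<bar> \<le> B"
    and drift: "\<And>x y. (\<integral>u. \<psi> (x + u) (y + u) \<partial>Leb) \<le> 0"
begin

lemma measurable_path_sum [measurable]: "(\<lambda>w. path_sum A v \<psi> w n x y) \<in> borel_measurable Omega"
  unfolding path_sum_def by measurable

lemma path_sum_Suc:
  "path_sum A v \<psi> (case_nat u w) (Suc n) x y =
     \<psi> (random_step A v u x) (random_step A v u y) + path_sum A v \<psi> w n (random_step A v u x) (random_step A v u y)"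
proof -
  have "path_sum A v \<psi> (case_nat u w) (Suc n) x y =
     (\<Sum>j=0..n. \<psi> (iteration A v (case_nat u w) (Suc j) x) (iteration A v (case_nat u w) (Suc j) y))"
    unfolding path_sum_def One_nat_def by (subst sum.shift_bounds_cl_Suc_ivl) simp
  also have "\<dots> = (\<Sum>j=0..n. \<psi> (iteration A v w j (random_step A v u x)) (iteration A v w j (random_step A v u y)))"
    by (simp only: iteration_case_nat)
  finally show ?thesis
    by (simp add: path_sum_def sum.atLeast_Suc_atMost)
qed

text \<open>In the second-order expansion the linear term has nonpositive mean by
  \<open>drift\<close>, and the square is at most \<open>(l * B)\<^sup>2\<close>.\<close>

lemma exp_moment_step:
  assumes l: "0 \<le> l" "l * B \<le> 1"
  shows "(\<integral>\<^sup>+u. exp (l * \<psi> (x + u) (y + u)) \<partial>Leb) \<le> exp ((l * B)\<^sup>2)"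
proof -
  have [measurable]: "(\<lambda>u. \<psi> (x + u) (y + u)) \<in> borel_measurable borel"
    by measurable
  have int: "integrable Leb (\<lambda>u. \<psi> (x + u) (y + u))"
    by (rule Leb.integrable_const_bound[of _ B]) (auto simp: bound)
  have abs: "\<bar>l * \<psi> a b\<bar> \<le> l * B" for a b
    using l bound[of a b] by (simp add: abs_mult mult_left_mono)
  have le: "exp (l * \<psi> a b) \<le> 1 + l * \<psi> a b + (l * B)\<^sup>2" for a b
  proof -
    have "(l * \<psi> a b)\<^sup>2 \<le> (l * B)\<^sup>2" using abs[of a b] by (metis abs_ge_zero power2_abs power_mono)
    moreover have "exp (l * \<psi> a b) \<le> 1 + l * \<psi> a b + (l * \<psi> a b)\<^sup>2"
      using abs[of a b] l by (intro exp_le_quadratic) linarith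
    ultimately show ?thesis by linarith
  qed
  have "(\<integral>\<^sup>+u. exp (l * \<psi> (x + u) (y + u)) \<partial>Leb) \<le> (\<integral>\<^sup>+u. ennreal (1 + l * \<psi> (x + u) (y + u) + (l * B)\<^sup>2) \<partial>Leb)"
    by (intro nn_integral_mono ennreal_leI le)
  also have "\<dots> = ennreal (\<integral>u. 1 + l * \<psi> (x + u) (y + u) + (l * B)\<^sup>2 \<partial>Leb)"
    using int by (intro nn_integral_eq_integral) (auto intro!: order.trans[OF less_imp_le[OF exp_gt_zero] le])
  also have "(\<integral>u. 1 + l * \<psi> (x + u) (y + u) + (l * B)\<^sup>2 \<partial>Leb) = 1 + l * (\<integral>u. \<psi> (x + u) (y + u) \<partial>Leb) + (l * B)\<^sup>2"
    using int by (simp add: Leb.prob_space[simplified])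
  also have "\<dots> \<le> 1 + (l * B)\<^sup>2"
    using drift[of x y] l by (simp add: mult_nonneg_nonpos)
  also have "\<dots> \<le> exp ((l * B)\<^sup>2)" by (rule exp_ge_add_one_self)
  finally show ?thesis by (simp add: ennreal_leI)
qed

text \<open>The recursion peels off the first letter of the sequence, not the last one: the induction
  hypothesis then applies to the two points after one step.\<close>

lemma exp_moment:
  assumes l: "0 \<le> l" "l * B \<le> 1"
  shows "(\<integral>\<^sup>+w. exp (l * path_sum A v \<psi> w n x y) \<partial>Omega) \<le> ennreal (exp ((l * B)\<^sup>2)) ^ n"
proof (induction n arbitrary: x y)
  case 0
  then show ?case by (simp add: path_sum_def Omega.emeasure_space_1)
next
  case (Suc n)
  let ?K = "ennreal (exp ((l * B)\<^sup>2))"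
  let ?f = "random_step A v"
  have [measurable]: "(\<lambda>u. \<psi> (step A v x + u) (step A v y + u)) \<in> borel_measurable borel"
    by measurable
  have "(\<integral>\<^sup>+w. exp (l * path_sum A v \<psi> w (Suc n) x y) \<partial>Omega) =
    (\<integral>\<^sup>+u. \<integral>\<^sup>+w. ennreal (exp (l * \<psi> (?f u x) (?f u y))) * ennreal (exp (l * path_sum A v \<psi> w n (?f u x) (?f u y))) \<partial>Omega \<partial>Leb)"
    by (subst nn_integral_Omega) (auto simp: path_sum_Suc distrib_left exp_add ennreal_mult)
  also have "\<dots> = (\<integral>\<^sup>+u. ennreal (exp (l * \<psi> (?f u x) (?f u y))) * (\<integral>\<^sup>+w. exp (l * path_sum A v \<psi> w n (?f u x) (?f u y)) \<partial>Omega) \<partial>Leb)"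
    by (subst nn_integral_cmult) auto
  also have "\<dots> \<le> (\<integral>\<^sup>+u. ennreal (exp (l * \<psi> (?f u x) (?f u y))) * ?K ^ n \<partial>Leb)"
    by (intro nn_integral_mono mult_left_mono Suc.IH) simp
  \<comment> \<open>The new letter translates the fixed points \<open>step A v x\<close> and
    \<open>step A v y\<close>, so the one-step bound applies to them.\<close>
  also have "\<dots> = (\<integral>\<^sup>+u. exp (l * \<psi> (step A v x + u) (step A v y + u)) \<partial>Leb) * ?K ^ n"
    by (subst nn_integral_multc[symmetric]) (auto simp: random_step_def translation_def)
  also have "\<dots> \<le> ?K * ?K ^ n"
    by (intro mult_right_mono exp_moment_step l) simp
  finally show ?case by simp
qed

lemma path_sum_tail:
  assumes t: "0 < t" "t \<le> B"
  shows "measure Omega {w \<in> space Omega. path_sum A v \<psi> w n x y \<ge> t * n} \<le> exp (- (t\<^sup>2 / (4 * B\<^sup>2))) ^ n"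
proof -
  \<comment> \<open>The minimiser of the Chernoff exponent \<open>(l * B)\<^sup>2 - l * t\<close>;
    the assumption \<open>t \<le> B\<close> gives \<open>l * B \<le> 1\<close>.\<close>
  define l where "l = t / (2 * B\<^sup>2)"
  have B: "B > 0" using t by simp
  have l: "l > 0" "l * B \<le> 1" using t B by (auto simp: l_def power2_eq_square field_simps)
  have "emeasure Omega {w \<in> space Omega. path_sum A v \<psi> w n x y \<ge> t * n} \<le>
     ennreal (exp (- l * (t * n))) * (\<integral>\<^sup>+w. ennreal (exp (l * path_sum A v \<psi> w n x y)) * indicator (space Omega) w \<partial>Omega)"
    by (rule Chernoff_ineq_nn_integral_ge) (use l in auto)
  also have "(\<integral>\<^sup>+w. ennreal (exp (l * path_sum A v \<psi> w n x y)) * indicator (space Omega) w \<partial>Omega) =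
    (\<integral>\<^sup>+w. exp (l * path_sum A v \<psi> w n x y) \<partial>Omega)"
    by (intro nn_integral_cong) simp
  also have "ennreal (exp (- l * (t * n))) * \<dots> \<le> ennreal (exp (- l * (t * n))) * ennreal (exp ((l * B)\<^sup>2)) ^ n"
    using l by (intro mult_left_mono exp_moment) auto
  also have "\<dots> = ennreal (exp (- l * (t * n)) * exp ((l * B)\<^sup>2) ^ n)"
    by (simp add: ennreal_mult ennreal_power)
  also have "exp (- l * (t * n)) * exp ((l * B)\<^sup>2) ^ n = exp (n * ((l * B)\<^sup>2 - l * t))"
    by (simp add: exp_of_nat_mult[symmetric] exp_add[symmetric] algebra_simps)
  also have "(l * B)\<^sup>2 - l * t = - (t\<^sup>2 / (4 * B\<^sup>2))"
    using B by (simp add: l_def field_simps power2_eq_square)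
  finally show ?thesis
    by (simp add: Omega.emeasure_eq_measure exp_of_nat_mult[symmetric])
qed

text \<open>The tails decay geometrically, hence are summable, and Borel-Cantelli applies.\<close>

lemma AE_eventually_path_sum_less:
  assumes t: "0 < t" "t \<le> B"
  shows "AE w in Omega. \<forall>\<^sub>F n in sequentially. path_sum A v \<psi> w n x y < t * real n"
proof -
  let ?E = "\<lambda>n. {w \<in> space Omega. path_sum A v \<psi> w n x y \<ge> t * n}"
  have "AE w in Omega. \<forall>\<^sub>F n in sequentially. w \<in> space Omega - ?E n"
  proof (rule borel_cantelli_AE1)
    show "summable (\<lambda>n. measure Omega (?E n))"
    proof (rule summable_comparison_test')
      show "norm (measure Omega (?E n)) \<le> exp (- (t\<^sup>2 / (4 * B\<^sup>2))) ^ n" for n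
        using path_sum_tail[OF t, of n x y] by simp
      show "summable (\<lambda>n. exp (- (t\<^sup>2 / (4 * B\<^sup>2))) ^ n)"
        using t by (intro summable_geometric) auto
    qed
  qed (auto simp: Omega.emeasure_eq_measure)
  then show ?thesis by (auto elim!: eventually_mono)
qed

end

end

subsection \<open>The Lyapunov function and the frequency of large distances\<close>

text \<open>The truncations at level \<open>1 / Suc n\<close> increase to \<open>1 / \<phi>\<close>,
  so monotone convergence makes their integrals unbounded.\<close>

lemma integral_truncated_inverse_large:
  fixes \<phi> :: "circle \<Rightarrow> real"
  assumes phi: "continuous_on UNIV \<phi>" and nonneg: "\<And>x. \<phi> x \<ge> 0"
    and inf: "(\<integral>\<^sup>+x. 1 / ennreal (\<phi> x) \<partial>Leb) = \<infinity>"
  obtains \<tau> where "\<tau> > 0" "(\<integral>x. 1 / max (\<phi> x) \<tau> \<partial>Leb) > M"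
proof -
  have phim [measurable]: "\<phi> \<in> borel_measurable borel"
    using phi by (rule continuous_circle_measurable)
  define f where "f n x = ennreal (1 / max (\<phi> x) (1 / Suc n))" for n x
  have sup: "(SUP n. f n x) = 1 / ennreal (\<phi> x)" for x
  proof (rule LIMSEQ_unique[OF LIMSEQ_SUP])
    show "incseq (\<lambda>n. f n x)"
      unfolding f_def
      by (intro incseq_SucI ennreal_leI divide_left_mono max.mono mult_pos_pos) (auto simp: field_simps less_max_iff_disj)
    show "(\<lambda>n. f n x) \<longlonglongrightarrow> 1 / ennreal (\<phi> x)"
    proof (cases "\<phi> x = 0")
      \<comment> \<open>In \<open>ennreal\<close> the quotient \<open>1 / 0\<close> is infinite,
        matching the limit of the truncated values \<open>Suc n\<close>.\<close>
      case True
      have "f n x = of_nat (Suc n)" for n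
        using True by (simp add: f_def ennreal_of_nat_eq_real_of_nat[symmetric] del: of_nat_Suc)
      moreover have "(\<lambda>n. of_nat (Suc n) :: ennreal) \<longlonglongrightarrow> \<infinity>"
        using LIMSEQ_Suc[OF of_nat_tendsto_top_ennreal] by simp
      ultimately show ?thesis using True by simp
    next
      case False
      then have pos: "\<phi> x > 0" using nonneg[of x] by simp
      have "(\<lambda>n. 1 / max (\<phi> x) (1 / real (Suc n))) \<longlonglongrightarrow> 1 / max (\<phi> x) 0"
        using pos by (intro tendsto_intros LIMSEQ_Suc[OF lim_1_over_n]) auto
      then have "(\<lambda>n. f n x) \<longlonglongrightarrow> ennreal (1 / \<phi> x)"
        using pos unfolding f_def by (intro tendsto_ennrealI) simp
      then show ?thesis using pos by (simp add: divide_ennreal flip: ennreal_1)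
    qed
  qed
  have meas: "f n \<in> borel_measurable Leb" for n unfolding f_def by measurable
  have "(SUP n. \<integral>\<^sup>+x. f n x \<partial>Leb) = (\<integral>\<^sup>+x. (SUP n. f n x) \<partial>Leb)"
  proof (rule nn_integral_monotone_convergence_SUP[symmetric])
    show "incseq f"
      unfolding f_def
      by (intro incseq_SucI le_funI ennreal_leI divide_left_mono max.mono mult_pos_pos) (auto simp: field_simps less_max_iff_disj)
  qed (rule meas)
  also have "\<dots> = \<infinity>" using inf by (simp add: sup)
  finally have "(SUP n. \<integral>\<^sup>+x. f n x \<partial>Leb) > ennreal M" by (metis ennreal_less_top infinity_ennreal_def)
  then obtain n where n: "ennreal M < (\<integral>\<^sup>+x. f n x \<partial>Leb)" by (auto simp: less_SUP_iff)
  have cont: "continuous_on UNIV (\<lambda>x. 1 / max (\<phi> x) (1 / Suc n))"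
    using phi by (intro continuous_intros) (auto simp: max_def)
  have "(\<integral>\<^sup>+x. f n x \<partial>Leb) = ennreal (\<integral>x. 1 / max (\<phi> x) (1 / Suc n) \<partial>Leb)"
    unfolding f_def using continuous_circle_integrable[OF cont]
    by (intro nn_integral_eq_integral) (auto simp: le_max_iff_disj)
  with n have "M < (\<integral>x. 1 / max (\<phi> x) (1 / Suc n) \<partial>Leb)"
    by (metis ennreal_leI not_less)
  then show ?thesis by (intro that[of "1 / Suc n"]) auto
qed

lemma lyapunov_function:
  fixes \<phi> :: "circle \<Rightarrow> real"
  assumes phi: "continuous_on UNIV \<phi>" and nonneg: "\<And>x. \<phi> x \<ge> 0" and zero: "\<And>x. \<phi> x = 0 \<Longrightarrow> x = 0"
    and inf: "(\<integral>\<^sup>+x. 1 / ennreal (\<phi> x) \<partial>Leb) = \<infinity>"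
    and min: "minimal (translation v)" and "\<delta> > 0" "\<eta> > 0"
  obtains h where "continuous_on UNIV h"
    "\<And>x. \<phi> x / 2 * second_diff v h x \<le> \<eta> - (if dist x 0 < \<delta> then 0 else 1)"
proof -
  have "\<exists>c>0. \<forall>x. dist x 0 \<ge> \<delta> \<longrightarrow> c \<le> \<phi> x"
  proof (cases "{x :: circle. dist x 0 \<ge> \<delta>} = {}")
    case False
    have "closed {x :: circle. dist x 0 \<ge> \<delta>}"
      by (intro closed_Collect_le continuous_intros)
    then have "compact {x :: circle. dist x 0 \<ge> \<delta>}"
      using compact_Int_closed[OF compact_circle] by simp
    from continuous_attains_inf[OF this False continuous_on_subset[OF phi]] obtain a where
      a: "dist a 0 \<ge> \<delta>" "\<And>x. dist x 0 \<ge> \<delta> \<Longrightarrow> \<phi> a \<le> \<phi> x" by auto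
    have "\<phi> a > 0" using a(1) \<open>\<delta> > 0\<close> zero[of a] nonneg[of a] by (cases "\<phi> a = 0") auto
    with a(2) show ?thesis by blast
  qed (auto intro!: exI[of _ 1])
  then obtain c where c: "c > 0" "\<And>x. dist x 0 \<ge> \<delta> \<Longrightarrow> c \<le> \<phi> x" by blast
  \<comment> \<open>The threshold is what makes the mean of \<open>g\<close> positive:
    \<open>2 * \<eta>\<close> times it is \<open>2 / c\<close>.\<close>
  obtain \<tau> where \<tau>: "\<tau> > 0" "(\<integral>x. 1 / max (\<phi> x) \<tau> \<partial>Leb) > 1 / (c * \<eta>)"
    using integral_truncated_inverse_large[OF phi nonneg inf] by metis
  define g where "g x = 2 * \<eta> * (1 / max (\<phi> x) \<tau>) - 2 / c" for x
  have cont: "continuous_on UNIV (\<lambda>x. 1 / max (\<phi> x) \<tau>)"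
    using phi \<tau>(1) by (intro continuous_intros) (auto simp: max_def)
  have g: "continuous_on UNIV g"
    unfolding g_def by (intro continuous_intros cont)
  have "(\<integral>x. g x \<partial>Leb) = 2 * \<eta> * (\<integral>x. 1 / max (\<phi> x) \<tau> \<partial>Leb) - 2 / c"
    unfolding g_def using continuous_circle_integrable[OF cont]
    by (simp add: Leb.prob_space[simplified] del: times_divide_eq_right)
  also have "\<dots> > 2 * \<eta> * (1 / (c * \<eta>)) - 2 / c"
    using \<tau>(2) \<open>\<eta> > 0\<close> by (intro diff_strict_right_mono mult_strict_left_mono) auto
  finally have "(\<integral>x. g x \<partial>Leb) > 0" using \<open>\<eta> > 0\<close> by simp
  from second_diff_minorant[OF g this min] obtain h where
    h: "continuous_on UNIV h" "\<And>x. second_diff v h x \<le> g x" by blast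
  show ?thesis
  proof (rule that[OF h(1)])
    fix x
    have "\<phi> x / 2 * second_diff v h x \<le> \<phi> x / 2 * g x"
      using h(2) nonneg by (intro mult_left_mono) auto
    \<comment> \<open>The first quotient is at most \<open>1\<close>; the second is nonnegative, and
      at least \<open>1\<close> at distance \<open>\<delta>\<close> or more from
      \<open>0\<close>.\<close>
    also have "\<dots> = \<eta> * (\<phi> x / max (\<phi> x) \<tau>) - \<phi> x / c"
      by (simp add: g_def algebra_simps)
    also have "\<dots> \<le> \<eta> * 1 - (if dist x 0 < \<delta> then 0 else 1)"
    proof (rule diff_mono)
      show "\<eta> * (\<phi> x / max (\<phi> x) \<tau>) \<le> \<eta> * 1"
        using \<tau>(1) \<open>\<eta> > 0\<close> by (intro mult_left_mono) (auto simp: divide_le_eq_1 less_max_iff_disj)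
      show "(if dist x 0 < \<delta> then 0 else 1) \<le> \<phi> x / c"
        using c nonneg[of x] by (auto simp: not_less)
    qed
    finally show "\<phi> x / 2 * second_diff v h x \<le> \<eta> - (if dist x 0 < \<delta> then 0 else 1)" by simp
  qed
qed

section \<open>The difference of two trajectories and its drift\<close>

lemma step_diff: "step A v y - step A v x =
    (if x \<notin> A \<and> y \<in> A then (y - x) + v else if x \<in> A \<and> y \<notin> A then (y - x) - v else y - x)"
  by (auto simp: step_def)

lemma iteration_diff: "iteration A v w (Suc n) y - iteration A v w (Suc n) x =
    step A v (iteration A v w n y) - step A v (iteration A v w n x)"
  by (simp add: random_step_def translation_def)

text \<open>For uniform \<open>z = x + u\<close> the difference \<open>d\<close> moves by
  \<open>v\<close> when only \<open>z + d\<close> is in \<open>A\<close>, by \<open>- v\<close> when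
  only \<open>z\<close> is. Both events have probability
  \<open>displacement A d / 2\<close>.\<close>

lemma integral_step_diff:
  assumes A [measurable]: "A \<in> sets borel" and h: "continuous_on UNIV h"
  shows "(\<integral>u. h (step A v (y + u) - step A v (x + u)) - h (y - x) \<partial>Leb) =
    displacement A (y - x) / 2 * second_diff v h (y - x)"
proof -
  define d where "d = y - x"
  let ?P = "{z. z \<notin> A \<and> z + d \<in> A}" and ?M = "{z. z \<in> A \<and> z + d \<notin> A}"
  define F where "F z = (h (d + v) - h d) * indicator ?P z + (h (d - v) - h d) * indicator ?M z" for z
  have [measurable]: "F \<in> borel_measurable borel" unfolding F_def by measurable
  have F: "h (step A v (z + d) - step A v z) - h d = F z" for z
    by (simp add: F_def step_diff)
  have "h (step A v (y + u) - step A v (x + u)) - h (y - x) = F (u + x)" for u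
    using F[of "u + x"] by (simp add: d_def add.commute add.left_commute)
  then have "(\<integral>u. h (step A v (y + u) - step A v (x + u)) - h (y - x) \<partial>Leb) = (\<integral>u. F u \<partial>Leb)"
    by (simp add: integral_Leb_add)
  also have "\<dots> = (h (d + v) - h d) * measure Leb ?P + (h (d - v) - h d) * measure Leb ?M"
    unfolding F_def by (subst Bochner_Integration.integral_add) (auto simp: integrable_indicator_iff less_top[symmetric])
  also have "\<dots> = displacement A d / 2 * second_diff v h d"
    by (simp add: measure_enter[OF A] measure_leave[OF A] second_diff_def field_simps)
  finally show ?thesis by (simp add: d_def)
qed

lemma AE_frequency_bound:
  fixes A :: "circle set" and v x y :: circle
  assumes A [measurable]: "A \<in> sets borel"
    and sym: "no_translational_symmetries A"
    and inf: "(\<integral>\<^sup>+ \<epsilon>. 1 / ennreal (displacement A \<epsilon>) \<partial>Leb) = \<infinity>"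
    and min: "minimal (translation v)" and "\<delta> > 0" "\<eta> > 0"
  shows "AE w in Omega. \<forall>\<^sub>F n in sequentially.
    real (card {j\<in>{1..n}. \<not> dist (iteration A v w j x) (iteration A v w j y) < \<delta>}) \<le> 3 * \<eta> * real n"
proof -
  obtain h where h: "continuous_on UNIV h"
    "\<And>d. displacement A d / 2 * second_diff v h d \<le> \<eta> - (if dist d 0 < \<delta> then 0 else 1)"
    using lyapunov_function[OF continuous_on_displacement[OF A] displacement_nonneg _ inf min \<open>\<delta> > 0\<close> \<open>\<eta> > 0\<close>]
      sym unfolding no_translational_symmetries_def by blast
  note [measurable] = continuous_circle_measurable[OF h(1)]
  have [measurable]: "step A v \<in> borel_measurable borel" by (rule measurable_step[OF A])
  obtain H where H: "H > 0" "\<And>x. \<bar>h x\<bar> \<le> H" using continuous_circle_bounded[OF h(1)] by metis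
  define out :: "circle \<Rightarrow> real" where "out d = (if dist d 0 < \<delta> then 0 else 1)" for d
  have [measurable]: "out \<in> borel_measurable borel" unfolding out_def by measurable
  have out_diff: "out (b - a) = (if \<not> dist a b < \<delta> then 1 else 0)" for a b
    using dist_circle_diff[of b a] dist_commute[of a b] by (simp add: out_def)
  \<comment> \<open>The next common translation cancels in the difference, so the next increment of
    \<open>h\<close> is a function of the present pair alone.\<close>
  define \<psi> where "\<psi> x y = h (step A v y - step A v x) - h (y - x) + (out (y - x) - \<eta>)" for x y
  \<comment> \<open>Besides bounding \<open>\<psi>\<close>, this constant exceeds
    \<open>\<eta>\<close>, as the tail estimate at level \<open>t = \<eta>\<close> requires.\<close>
  define B where "B = 2 * H + 1 + \<eta>"
  have psi [measurable]: "(\<lambda>(x, y). \<psi> x y) \<in> borel_measurable (borel \<Otimes>\<^sub>M borel)"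
    unfolding \<psi>_def by measurable
  have bound: "\<bar>\<psi> x y\<bar> \<le> B" for x y
    using H(2)[of "step A v y - step A v x"] H(2)[of "y - x"] \<open>\<eta> > 0\<close>
    by (auto simp: \<psi>_def B_def out_def)
  have drift: "(\<integral>u. \<psi> (x + u) (y + u) \<partial>Leb) \<le> 0" for x y
  proof -
    have "(\<lambda>u. h (step A v (y + u) - step A v (x + u)) - h (y - x)) \<in> borel_measurable borel"
      by measurable
    then have int: "integrable Leb (\<lambda>u. h (step A v (y + u) - step A v (x + u)) - h (y - x))"
    proof (intro Leb.integrable_const_bound[of _ "2 * H"] AE_I2)
      fix u
      show "norm (h (step A v (y + u) - step A v (x + u)) - h (y - x)) \<le> 2 * H"
        using H(2)[of "step A v (y + u) - step A v (x + u)"] H(2)[of "y - x"]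
        unfolding real_norm_def by linarith
    qed simp
    have "(\<integral>u. \<psi> (x + u) (y + u) \<partial>Leb) =
      (\<integral>u. h (step A v (y + u) - step A v (x + u)) - h (y - x) \<partial>Leb) + (out (y - x) - \<eta>)"
      unfolding \<psi>_def using int by (simp add: Leb.prob_space[simplified])
    also have "\<dots> \<le> 0"
      using h(2)[of "y - x"] by (simp add: integral_step_diff[OF A h(1)] out_def)
    finally show ?thesis .
  qed
  have tel: "path_sum A v \<psi> w n x y =
      h (iteration A v w (Suc n) y - iteration A v w (Suc n) x) - h (iteration A v w 1 y - iteration A v w 1 x)
      + card {j\<in>{1..n}. \<not> dist (iteration A v w j x) (iteration A v w j y) < \<delta>} - \<eta> * n" for w n
  proof -
    let ?D = "\<lambda>j. iteration A v w j y - iteration A v w j x"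
    have "path_sum A v \<psi> w n x y = (\<Sum>j=1..n. h (?D (Suc j)) - h (?D j)) + (\<Sum>j=1..n. out (?D j)) - \<eta> * n"
      unfolding path_sum_def \<psi>_def iteration_diff[symmetric]
      by (simp add: sum.distrib sum_subtractf del: iteration.simps)
    moreover have "(\<Sum>j=1..n. h (?D (Suc j)) - h (?D j)) = h (?D (Suc n)) - h (?D 1)"
      by (induction n) (auto simp del: iteration.simps)
    moreover have "(\<Sum>j=1..n. out (?D j)) = card {j\<in>{1..n}. \<not> dist (iteration A v w j x) (iteration A v w j y) < \<delta>}"
      unfolding out_diff by (simp add: sum.If_cases Int_def)
    ultimately show ?thesis by simp
  qed
  have "AE w in Omega. \<forall>\<^sub>F n in sequentially. path_sum A v \<psi> w n x y < \<eta> * real n"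
    using AE_eventually_path_sum_less[OF A psi bound drift, of \<eta>] \<open>\<eta> > 0\<close> H(1) by (simp add: B_def)
  then show ?thesis
  proof eventually_elim
    case (elim w)
    \<comment> \<open>The factor \<open>3\<close> collects one \<open>\<eta> * n\<close> from the
      path sum, one from the constant in \<open>\<psi>\<close>, and one absorbing the two boundary
      values of \<open>h\<close>.\<close>
    moreover have "\<forall>\<^sub>F n in sequentially. 2 * H / \<eta> \<le> real n"
      using filterlim_real_sequentially unfolding filterlim_at_top by blast
    ultimately show "\<forall>\<^sub>F n in sequentially.
      real (card {j\<in>{1..n}. \<not> dist (iteration A v w j x) (iteration A v w j y) < \<delta>}) \<le> 3 * \<eta> * real n"
    proof eventually_elim
      case (elim n)
      have "2 * H \<le> \<eta> * real n" using elim(2) \<open>\<eta> > 0\<close> by (simp add: field_simps)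
      then show ?case
        using elim(1) H(2)[of "iteration A v w (Suc n) y - iteration A v w (Suc n) x"]
          H(2)[of "iteration A v w 1 y - iteration A v w 1 x"]
        unfolding tel by (simp add: abs_le_iff del: iteration.simps)
    qed
  qed
qed

theorem theorem1:
  fixes A :: "circle set" and v :: circle
  assumes "A \<in> sets borel"
    and "no_translational_symmetries A"
    and "(\<integral>\<^sup>+ \<epsilon>. 1 / ennreal (displacement A \<epsilon>) \<partial>Leb) = \<infinity>"
    and "minimal (translation v)"
  shows "\<forall>x y. AE w in Omega. \<forall>\<delta>>0.
    (\<lambda>N. real (card {n \<in> {1..N}. dist (iteration A v w n x) (iteration A v w n y) < \<delta>}) / real N)
      \<longlonglongrightarrow> 1"
proof (intro allI)
  fix x y
  let ?near = "\<lambda>w \<delta> N. {n \<in> {1..N}. dist (iteration A v w n x) (iteration A v w n y) < \<delta>}"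
  let ?far = "\<lambda>w \<delta> N. {n \<in> {1..N}. \<not> dist (iteration A v w n x) (iteration A v w n y) < \<delta>}"
  let ?r = "\<lambda>k. 1 / real (Suc k)"
  \<comment> \<open>Countably many tolerances, serving as both \<open>\<delta>\<close> and
    \<open>\<eta>\<close>, give one null set; monotonicity in the distance then covers every
    \<open>\<delta>\<close>.\<close>
  have "AE w in Omega. \<forall>k. \<forall>\<^sub>F N in sequentially. real (card (?far w (?r k) N)) \<le> 3 * ?r k * real N"
    unfolding AE_all_countable by (intro allI AE_frequency_bound[OF assms]) simp_all
  then show "AE w in Omega. \<forall>\<delta>>0. (\<lambda>N. real (card (?near w \<delta> N)) / real N) \<longlonglongrightarrow> 1"
  proof eventually_elim
    case (elim w)
    show ?case
    proof (intro allI impI tendstoI)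
      fix \<delta> e :: real assume "\<delta> > 0" "e > 0"
      then have "min \<delta> (e / 4) > 0" by simp
      \<comment> \<open>The bound \<open>e / 4\<close> leaves room for the factor \<open>3\<close>
        in the frequency estimate.\<close>
      then obtain k where k: "?r k < \<delta>" "?r k < e / 4"
        using reals_Archimedean[of "min \<delta> (e / 4)"] by (auto simp: inverse_eq_divide)
      show "\<forall>\<^sub>F N in sequentially. dist (real (card (?near w \<delta> N)) / real N) 1 < e"
        using elim[rule_format, of k] eventually_gt_at_top[of 0]
      proof eventually_elim
        case (elim N)
        have "{1..N} = ?near w \<delta> N \<union> ?far w \<delta> N" by auto
        then have "card {1..N} = card (?near w \<delta> N \<union> ?far w \<delta> N)" by (rule arg_cong)
        also have "\<dots> = card (?near w \<delta> N) + card (?far w \<delta> N)"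
          by (rule card_Un_disjoint) auto
        finally have "N = card (?near w \<delta> N) + card (?far w \<delta> N)" by simp
        moreover have "card (?far w \<delta> N) \<le> card (?far w (?r k) N)"
          using k(1) by (intro card_mono) auto
        ultimately have "real N - real (card (?near w \<delta> N)) \<le> 3 * ?r k * real N"
            "real (card (?near w \<delta> N)) \<le> real N"
          using elim(1) by linarith+
        moreover have "3 * ?r k * real N < e * real N"
          using k(2) elim(2) \<open>e > 0\<close> by (intro mult_strict_right_mono) linarith+
        ultimately have "real N - real (card (?near w \<delta> N)) < e * real N"
            "real (card (?near w \<delta> N)) \<le> real N" by linarith+
        then show ?case
          using elim(2) by (auto simp: dist_real_def abs_less_iff field_simps)
      qed
    qed
  qed
qed

end
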